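(* Let $Q_n$ be a step CDF with atoms $C_{(1)}<\dots<C_{(M)}$ and jump masses $\Delta_i\ge0$, let $K$ be a kernel, and for $h>0$ let $d_j(h)$ be the signed deviation of the kernel-smoothed CDF with bandwidth $h$ from the midpoint target at atom $C_{(j)}$ (all defined in the context). For $\varepsilon>0$ put $$\mathcal{F}_j=\{h>0:\ |d_j(h)|\le\varepsilon\},\qquad \mathcal{F}=\bigcap_{j=1}^M\mathcal{F}_j=\Bigl\{h>0:\ \max_{1\le j\le M}|d_j(h)|\le\varepsilon\Bigr\},\qquad h^\star=\sup\mathcal{F}.$$ Then for any sufficiently small $\varepsilon>0$ the feasible set $\mathcal{F}$ is non-empty, so $h^\star>0$ is well defined. Moreover $\mathcal{F}$ is bounded above and the supremum is attained, i.e. $h^\star=\max\{h>0:\max_{1\le j\le M}|d_j(h)|\le\varepsilon\}$.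
   Context: A kernel $K$ is a symmetric, non-negative, integrable function on $\mathbb{R}$ with $\int K=1$; its CDF is $\mathbb{K}(t)=\int_{-\infty}^tK(s)\,ds$, and $\overline{\mathbb{K}}=1-\mathbb{K}$. The step CDF $Q_n$ is a piecewise-constant, right-continuous function with jumps at the ordered locations (atoms) $C_{(1)}<\dots<C_{(M)}$; its levels are $F_i=Q_n(C_{(i)}^+)$ (right limit) and $F_0=Q_n(C_{(1)}^-)$, and its jump masses are $\Delta_i=F_i-F_{i-1}\ge0$, so that $Q_n(y)=\sum_{i=1}^M\Delta_iH(y-C_{(i)})$ with $H$ the Heaviside step function. The smoothed CDF with bandwidth $h>0$ is $Q_n^h(y)=\sum_{i=1}^M\Delta_i\,\mathbb{K}\bigl((y-C_{(i)})/h\bigr)$. The midpoint target at atom $C_{(j)}$ is $t_j=\tfrac12(F_{j-1}+F_j)=F_{j-1}+\tfrac12\Delta_j$, and the signed deviation is $$d_j(h)=Q_n^h(C_{(j)})-t_j=\sum_{i>j}\Delta_i\,\overline{\mathbb{K}}\Bigl(\tfrac{C_{(i)}-C_{(j)}}{h}\Bigr)-\sum_{i<j}\Delta_i\,\overline{\mathbb{K}}\Bigl(\tfrac{C_{(j)}-C_{(i)}}{h}\Bigr).$$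
   Formalization: The formal statement assumes at least two atoms (M ≥ 2) and positive total mass at most 1; with a single atom the deviation vanishes for every h, so the feasible set is all of (0,∞) and is not bounded above. *)

theory Defs
  imports "HOL-Analysis.Analysis"
begin

definition is_kernel :: "(real \<Rightarrow> real) \<Rightarrow> bool" where
  "is_kernel K \<longleftrightarrow>
     (\<forall>x. K (- x) = K x) \<and> (\<forall>x. 0 \<le> K x) \<and>
     integrable lebesgue K \<and> (LINT s|lebesgue. K s) = 1"

definition kernel_cdf :: "(real \<Rightarrow> real) \<Rightarrow> real \<Rightarrow> real" where
  "kernel_cdf K t = (LINT s:{..t}|lebesgue. K s)"

text \<open>
  The atoms are \<open>C 1 < \<dots> < C M\<close>; values of \<open>C\<close> outside \<open>{1..M}\<close> are irrelevant. The fourth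
  conjunct says that \<open>Q\<close> is constant on each piece between consecutive atoms, left endpoint
  included, and hence right-continuous. Atoms may carry zero mass. The total mass \<open>L\<close> is only
  required to lie in \<open>(0,1]\<close>, so that defective distribution functions are covered as well as
  proper ones (\<open>L = 1\<close>).
\<close>
definition step_cdf :: "(real \<Rightarrow> real) \<Rightarrow> nat \<Rightarrow> (nat \<Rightarrow> real) \<Rightarrow> bool" where
  "step_cdf Q M C \<longleftrightarrow>
     strict_mono_on {1..M} C \<and>
     mono Q \<and>
     (Q \<longlongrightarrow> 0) at_bot \<and>
     (\<forall>x y. x \<le> y \<and> C ` {1..M} \<inter> {x<..y} = {} \<longrightarrow> Q x = Q y) \<and>
     (\<exists>L. 0 < L \<and> L \<le> 1 \<and> (Q \<longlongrightarrow> L) at_top)"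

definition level :: "(real \<Rightarrow> real) \<Rightarrow> (nat \<Rightarrow> real) \<Rightarrow> nat \<Rightarrow> real" where
  "level Q C i = (if i = 0 then Lim (at_left (C 1)) Q else Lim (at_right (C i)) Q)"

definition jump :: "(real \<Rightarrow> real) \<Rightarrow> (nat \<Rightarrow> real) \<Rightarrow> nat \<Rightarrow> real" where
  "jump Q C i = level Q C i - level Q C (i - 1)"

definition smoothed_cdf ::
  "(real \<Rightarrow> real) \<Rightarrow> (real \<Rightarrow> real) \<Rightarrow> nat \<Rightarrow> (nat \<Rightarrow> real) \<Rightarrow> real \<Rightarrow> real \<Rightarrow> real" where
  "smoothed_cdf K Q M C h y = (\<Sum>i=1..M. jump Q C i * kernel_cdf K ((y - C i) / h))"

definition midpoint_target :: "(real \<Rightarrow> real) \<Rightarrow> (nat \<Rightarrow> real) \<Rightarrow> nat \<Rightarrow> real" where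
  "midpoint_target Q C j = (level Q C (j - 1) + level Q C j) / 2"

definition deviation ::
  "(real \<Rightarrow> real) \<Rightarrow> (real \<Rightarrow> real) \<Rightarrow> nat \<Rightarrow> (nat \<Rightarrow> real) \<Rightarrow> nat \<Rightarrow> real \<Rightarrow> real" where
  "deviation K Q M C j h = smoothed_cdf K Q M C h (C j) - midpoint_target Q C j"

definition feasible_at ::
  "(real \<Rightarrow> real) \<Rightarrow> (real \<Rightarrow> real) \<Rightarrow> nat \<Rightarrow> (nat \<Rightarrow> real) \<Rightarrow> real \<Rightarrow> nat \<Rightarrow> real set" where
  "feasible_at K Q M C \<epsilon> j = {h. 0 < h \<and> \<bar>deviation K Q M C j h\<bar> \<le> \<epsilon>}"

definition feasible ::
  "(real \<Rightarrow> real) \<Rightarrow> (real \<Rightarrow> real) \<Rightarrow> nat \<Rightarrow> (nat \<Rightarrow> real) \<Rightarrow> real \<Rightarrow> real set" where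
  "feasible K Q M C \<epsilon> = (\<Inter>j\<in>{1..M}. feasible_at K Q M C \<epsilon> j)"

definition h_star ::
  "(real \<Rightarrow> real) \<Rightarrow> (real \<Rightarrow> real) \<Rightarrow> nat \<Rightarrow> (nat \<Rightarrow> real) \<Rightarrow> real \<Rightarrow> real" where
  "h_star K Q M C \<epsilon> = Sup (feasible K Q M C \<epsilon>)"

end

theory Submission
  imports Defs
begin

text \<open>
  As \<open>h \<rightarrow> 0\<close> every deviation tends to \<open>0\<close>, because \<open>kernel_cdf K 0 = 1/2\<close> by symmetry, so
  the feasible set is non-empty for every \<open>\<epsilon> > 0\<close>. As \<open>h \<rightarrow> \<infinity>\<close> the smoothed distribution function
  flattens to half the total mass \<open>L\<close>, so the \<open>j\<close>-th deviation tends to \<open>L/2 - t\<^sub>j\<close>. The midpoint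
  targets at the first and the last atom differ by at least \<open>L/2\<close>, hence one of these two limits
  is nonzero; its absolute value is the threshold below which \<open>\<epsilon>\<close> forces \<open>h\<close> to be bounded. The supremum
  is attained since the deviations are continuous in \<open>h > 0\<close>.
\<close>

section \<open>Symmetry, continuity and limits of the kernel CDF\<close>

lemma kernel_set_integrable:
  assumes "is_kernel K" "S \<in> sets lebesgue"
  shows "set_integrable lebesgue S K"
  using assms integrable_mult_indicator[of S lebesgue K]
  by (simp add: is_kernel_def set_integrable_def)

lemma AE_lebesgue_neq: "AE s in lebesgue. s \<noteq> (a::real)"
  by (intro AE_completion AE_lborel_singleton)

text \<open>The substitution of \<open>-s\<close> for \<open>s\<close> carries the tail left of
  \<open>-t\<close> to the tail right of \<open>t\<close>. The half-lines on either side of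
  \<open>t\<close> cover the real line and share only a null set, so the two integrals add up to the
  total mass 1.\<close>

lemma kernel_cdf_reflect:
  assumes K: "is_kernel K"
  shows "kernel_cdf K (- t) = 1 - kernel_cdf K t"
proof -
  have int: "set_integrable lebesgue S K" if "S \<in> sets lebesgue" for S
    using kernel_set_integrable[OF K that] .
  have even: "(\<lambda>x. K (- x)) = K"
    using K by (simp add: is_kernel_def)
  \<comment> \<open>The reflection rule speaks of gauge integrals. Integrability of \<open>K\<close>
    on half-lines allows passing to them and back.\<close>
  have "uminus ` {..-t} \<subseteq> {t..}" "uminus ` {t..} \<subseteq> {..-t}"
    by auto
  then have "integral {..-t} K = integral {t..} K"
    using has_absolute_integral_reflect_real[of "{..-t}" "{t..}" K "integral {t..} K"]
      int[of "{t..}"] by (simp add: even)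
  then have refl: "kernel_cdf K (- t) = (LINT s:{t..}|lebesgue. K s)"
    unfolding kernel_cdf_def by (simp add: set_lebesgue_integral_eq_integral(2) int)
  have ae: "AE s in lebesgue. \<not> (s \<in> {..t} \<and> s \<in> {t..})"
    using AE_lebesgue_neq[of t] by eventually_elim auto
  have "(LINT s:{..t}\<union>{t..}|lebesgue. K s) = kernel_cdf K t + kernel_cdf K (- t)"
    unfolding refl unfolding kernel_cdf_def
    by (rule set_integral_Un_AE[OF ae]) (auto intro: int)
  moreover have "{..t} \<union> {t..} = UNIV"
    by auto
  ultimately show ?thesis
    using K by (simp add: is_kernel_def set_lebesgue_integral_def)
qed

lemma kernel_cdf_0:
  assumes "is_kernel K"
  shows "kernel_cdf K 0 = 1/2"
  using kernel_cdf_reflect[OF assms, of 0] by simp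

text \<open>Dominated convergence with majorant \<open>K\<close>: for \<open>u n\<close> tending to
  \<open>t\<close>, the indicators of the half-lines converge at every point other than
  \<open>t\<close>.\<close>

lemma isCont_kernel_cdf:
  assumes K: "is_kernel K"
  shows "isCont (kernel_cdf K) t"
proof (rule continuous_at_sequentiallyI)
  fix u assume u: "u \<longlonglongrightarrow> t"
  have meas: "(\<lambda>s. indicator {..x} s *\<^sub>R K s) \<in> borel_measurable lebesgue" for x
    using kernel_set_integrable[OF K, of "{..x}"] unfolding set_integrable_def
    by (intro borel_measurable_integrable) simp
  show "(\<lambda>n. kernel_cdf K (u n)) \<longlonglongrightarrow> kernel_cdf K t"
    unfolding kernel_cdf_def set_lebesgue_integral_def
  proof (rule integral_dominated_convergence[where w = K])
    show "AE s in lebesgue. (\<lambda>n. indicator {..u n} s *\<^sub>R K s) \<longlonglongrightarrow> indicator {..t} s *\<^sub>R K s"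
      using AE_lebesgue_neq[of t]
    proof eventually_elim
      case (elim s)
      have "eventually (\<lambda>n. indicator {..u n} s = (indicator {..t} s :: real)) sequentially"
      proof (cases "s < t")
        case True
        from order_tendstoD(1)[OF u True] show ?thesis
          by eventually_elim (use True in \<open>auto simp: indicator_def\<close>)
      next
        case False
        with elim have "t < s" by simp
        from order_tendstoD(2)[OF u this] show ?thesis
          by eventually_elim (use \<open>t < s\<close> in \<open>auto simp: indicator_def\<close>)
      qed
      then show ?case
        by (intro tendsto_scaleR tendsto_const) (rule tendsto_eventually)
    qed
  qed (use K meas in \<open>auto simp: is_kernel_def indicator_def intro: borel_measurable_integrable simp del: real_scaleR_def\<close>)
qed

lemma kernel_cdf_at_top:
  assumes K: "is_kernel K"
  shows "(kernel_cdf K \<longlongrightarrow> 1) at_top"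
proof -
  have meas: "(\<lambda>s. indicator {..x} s *\<^sub>R K s) \<in> borel_measurable lebesgue" for x
    using kernel_set_integrable[OF K, of "{..x}"] unfolding set_integrable_def
    by (intro borel_measurable_integrable) simp
  have "((\<lambda>t. LINT s|lebesgue. indicator {..t} s *\<^sub>R K s) \<longlongrightarrow> (LINT s|lebesgue. K s)) at_top"
  proof (rule integral_dominated_convergence_at_top[where w = K])
    show "AE s in lebesgue. ((\<lambda>t. indicator {..t} s *\<^sub>R K s) \<longlongrightarrow> K s) at_top"
    proof (intro AE_I2 tendsto_eventually)
      fix s
      show "\<forall>\<^sub>F t in at_top. indicator {..t} s *\<^sub>R K s = K s"
        using eventually_ge_at_top[of s] by eventually_elim simp
    qed
  qed (use K meas in \<open>auto simp: is_kernel_def indicator_def intro: borel_measurable_integrable simp del: real_scaleR_def\<close>)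
  then show ?thesis
    using K by (simp add: is_kernel_def kernel_cdf_def[abs_def] set_lebesgue_integral_def)
qed

lemma kernel_cdf_at_bot:
  assumes K: "is_kernel K"
  shows "(kernel_cdf K \<longlongrightarrow> 0) at_bot"
proof -
  have "((\<lambda>t. 1 - kernel_cdf K t) \<longlongrightarrow> 1 - 1) at_top"
    by (intro tendsto_intros kernel_cdf_at_top[OF K])
  then show ?thesis
    by (simp add: filterlim_at_bot_mirror kernel_cdf_reflect[OF K])
qed

section \<open>Levels and jumps of the step CDF\<close>

lemma step_cdf_level:
  assumes Q: "step_cdf Q M C" and i: "i \<in> {1..M}"
  shows "level Q C i = Q (C i)"
proof -
  \<comment> \<open>There are finitely many atoms, so some interval just to the right of
    \<open>C i\<close> contains none, and \<open>Q\<close> is constant there.\<close>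
  have "\<forall>\<^sub>F y in at_right (C i). \<forall>a\<in>C ` {1..M}. a \<notin> {C i<..y}"
  proof (rule eventually_ball_finite, simp, rule ballI)
    fix a
    show "\<forall>\<^sub>F y in at_right (C i). a \<notin> {C i<..y}"
    proof (cases "C i < a")
      case True
      then show ?thesis
        using eventually_at_right_less[of a]
        by (auto simp: eventually_at_right_field intro!: exI[of _ a])
    qed simp
  qed
  then have "\<forall>\<^sub>F y in at_right (C i). Q y = Q (C i)"
    using eventually_at_right_less[of "C i"]
  proof eventually_elim
    case (elim y)
    then have "C i \<le> y" "C ` {1..M} \<inter> {C i<..y} = {}"
      by auto
    then show ?case
      using Q unfolding step_cdf_def by metis
  qed
  then have "(Q \<longlongrightarrow> Q (C i)) (at_right (C i))"
    by (rule tendsto_eventually)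
  then show ?thesis
    using i by (simp add: level_def tendsto_Lim)
qed

text \<open>No atom lies left of \<open>C 1\<close>, so \<open>Q\<close> is constant there and
  equals its limit at minus infinity.\<close>

lemma step_cdf_level_0:
  assumes Q: "step_cdf Q M C"
  shows "level Q C 0 = 0"
proof -
  have C: "C 1 \<le> C k" if "k \<in> {1..M}" for k
    using Q that strict_mono_on_leD[of "{1..M}" C 1 k] by (auto simp: step_cdf_def)
  have const: "Q x = Q y" if "x \<le> y" "y < C 1" for x y
  proof -
    have "C ` {1..M} \<inter> {x<..y} = {}"
      using C that by fastforce
    then show ?thesis
      using Q that unfolding step_cdf_def by blast
  qed
  have "Q y = 0" if "y < C 1" for y
  proof -
    have "\<forall>\<^sub>F x in at_bot. Q x = Q y"
      using eventually_le_at_bot[of y] by eventually_elim (use const that in auto)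
    then have "(Q \<longlongrightarrow> Q y) at_bot"
      by (rule tendsto_eventually)
    then show ?thesis
      using Q tendsto_unique[of at_bot Q "Q y" 0] by (simp add: step_cdf_def)
  qed
  then have "\<forall>\<^sub>F y in at_left (C 1). Q y = 0"
    by (auto simp: eventually_at_left_field intro!: exI[of _ "C 1 - 1"])
  then have "(Q \<longlongrightarrow> 0) (at_left (C 1))"
    by (rule tendsto_eventually)
  then show ?thesis
    by (simp add: level_def tendsto_Lim)
qed

lemma step_cdf_at_top:
  assumes Q: "step_cdf Q M C" and M: "M \<ge> 1"
  shows "(Q \<longlongrightarrow> Q (C M)) at_top"
proof (rule tendsto_eventually)
  have C: "C k \<le> C M" if "k \<in> {1..M}" for k
    using Q M that strict_mono_on_leD[of "{1..M}" C k M] by (auto simp: step_cdf_def)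
  show "\<forall>\<^sub>F y in at_top. Q y = Q (C M)"
    using eventually_ge_at_top[of "C M"]
  proof eventually_elim
    case (elim y)
    moreover have "C ` {1..M} \<inter> {C M<..y} = {}"
      using C by fastforce
    ultimately show ?case
      using Q unfolding step_cdf_def by metis
  qed
qed

lemma step_cdf_level_last_pos:
  assumes Q: "step_cdf Q M C" and M: "M \<ge> 1"
  shows "0 < level Q C M"
proof -
  obtain L where "0 < L" "(Q \<longlongrightarrow> L) at_top"
    using Q by (auto simp: step_cdf_def)
  moreover from this have "L = Q (C M)"
    using tendsto_unique[OF _ _ step_cdf_at_top[OF Q M]] by simp
  ultimately show ?thesis
    using M by (simp add: step_cdf_level[OF Q])
qed

lemma sum_jump:
  assumes "step_cdf Q M C"
  shows "(\<Sum>i=1..n. jump Q C i) = level Q C n"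
  by (induction n) (simp_all add: step_cdf_level_0[OF assms] jump_def)

text \<open>This puts the target in the same form as \<open>smoothed_cdf\<close>: the weights 1,
  1/2, 0 are the limits of the kernel CDF factors as the bandwidth tends to 0, which permits a
  termwise comparison.\<close>

lemma midpoint_target_eq_sum:
  assumes Q: "step_cdf Q M C" and j: "j \<in> {1..M}"
  shows "midpoint_target Q C j =
    (\<Sum>i=1..M. jump Q C i * (if i < j then 1 else if i = j then 1/2 else 0))"
    (is "_ = (\<Sum>i=1..M. ?f i)")
proof -
  have "(\<Sum>i=1..M. ?f i) = (\<Sum>i\<in>{1..j}. ?f i)"
    using j by (intro sum.mono_neutral_right) auto
  also have "{1..j} = insert j {1..j-1}"
    using j by auto
  also have "(\<Sum>i\<in>insert j {1..j-1}. ?f i) = jump Q C j / 2 + (\<Sum>i=1..j-1. jump Q C i)"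
    using j by (subst sum.insert) (auto intro!: sum.cong)
  finally show ?thesis
    unfolding sum_jump[OF Q] by (simp add: midpoint_target_def jump_def field_simps)
qed

section \<open>Limits and continuity of the deviations in the bandwidth\<close>

lemma deviation_at_0:
  assumes K: "is_kernel K" and Q: "step_cdf Q M C" and j: "j \<in> {1..M}"
  shows "(deviation K Q M C j \<longlongrightarrow> 0) (at_right 0)"
proof -
  have "((\<lambda>h. kernel_cdf K ((C j - C i) / h)) \<longlongrightarrow>
      (if i < j then 1 else if i = j then 1/2 else 0)) (at_right 0)" if i: "i \<in> {1..M}" for i
  proof -
    \<comment> \<open>The argument of the kernel CDF tends to plus infinity, is constantly 0, or
      tends to minus infinity, respectively.\<close>
    consider "i < j" | "i = j" | "j < i" by linarith
    then show ?thesis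
    proof cases
      case 1
      then have "0 < C j - C i"
        using Q i j strict_mono_onD[of "{1..M}" C i j] by (auto simp: step_cdf_def)
      then have "filterlim (\<lambda>h. (C j - C i) / h) at_top (at_right 0)"
        unfolding divide_inverse
        by (intro filterlim_tendsto_pos_mult_at_top[OF tendsto_const _ filterlim_inverse_at_top_right])
      with 1 show ?thesis
        using filterlim_compose[OF kernel_cdf_at_top[OF K]] by simp
    next
      case 2
      then show ?thesis by (simp add: kernel_cdf_0[OF K])
    next
      case 3
      then have "C j - C i < 0"
        using Q i j strict_mono_onD[of "{1..M}" C j i] by (auto simp: step_cdf_def)
      then have "filterlim (\<lambda>h. (C j - C i) / h) at_bot (at_right 0)"
        unfolding divide_inverse
        by (intro filterlim_tendsto_neg_mult_at_bot[OF tendsto_const _ filterlim_inverse_at_top_right])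
      with 3 show ?thesis
        using filterlim_compose[OF kernel_cdf_at_bot[OF K]] by simp
    qed
  qed
  then have "((\<lambda>h. smoothed_cdf K Q M C h (C j)) \<longlongrightarrow> midpoint_target Q C j) (at_right 0)"
    unfolding smoothed_cdf_def midpoint_target_eq_sum[OF Q j]
    by (intro tendsto_sum tendsto_mult tendsto_const)
  then show ?thesis
    unfolding deviation_def[abs_def] by (simp add: LIM_zero)
qed

text \<open>All arguments of the kernel CDF tend to 0, where it is continuous with value 1/2. Each
  jump thus contributes half its mass, and the jumps sum to the top level.\<close>

lemma deviation_at_top:
  assumes K: "is_kernel K" and Q: "step_cdf Q M C"
  shows "(deviation K Q M C j \<longlongrightarrow> level Q C M / 2 - midpoint_target Q C j) at_top"
proof -
  have "((\<lambda>h. kernel_cdf K ((C j - C i) / h)) \<longlongrightarrow> 1/2) at_top" for i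
  proof -
    have "((\<lambda>h. (C j - C i) / h) \<longlongrightarrow> 0) at_top"
      by (intro tendsto_divide_0[OF tendsto_const] filterlim_at_top_imp_at_infinity filterlim_ident)
    then show ?thesis
      using isCont_tendsto_compose[OF isCont_kernel_cdf[OF K, of 0]] kernel_cdf_0[OF K] by metis
  qed
  then have "((\<lambda>h. smoothed_cdf K Q M C h (C j)) \<longlongrightarrow> (\<Sum>i=1..M. jump Q C i * (1/2))) at_top"
    unfolding smoothed_cdf_def by (intro tendsto_sum tendsto_mult tendsto_const)
  then have "((\<lambda>h. smoothed_cdf K Q M C h (C j)) \<longlongrightarrow> level Q C M / 2) at_top"
    unfolding sum_distrib_right[symmetric] sum_jump[OF Q] by simp
  then show ?thesis
    unfolding deviation_def[abs_def] by (intro tendsto_intros)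
qed

lemma isCont_deviation:
  assumes K: "is_kernel K" and h: "h \<noteq> 0"
  shows "isCont (deviation K Q M C j) h"
  unfolding deviation_def[abs_def] smoothed_cdf_def
  by (intro continuous_intros isCont_o2[OF _ isCont_kernel_cdf[OF K]]) (use h in auto)

text \<open>With \<open>level Q C 0 = 0\<close>, the difference is half of
  \<open>level Q C M\<close> plus half of \<open>level Q C (M - 1) - level Q C 1\<close>. The latter
  is non-negative by monotonicity, as \<open>M - 1\<close> is still the index of an atom.\<close>

lemma midpoint_target_diff:
  assumes Q: "step_cdf Q M C" and M: "M \<ge> 2"
  shows "level Q C M / 2 \<le> midpoint_target Q C M - midpoint_target Q C 1"
proof -
  have "C 1 \<le> C (M - 1)"
    using Q M strict_mono_on_leD[of "{1..M}" C 1 "M - 1"] by (auto simp: step_cdf_def)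
  then have "level Q C 1 \<le> level Q C (M - 1)"
    using Q M by (simp add: step_cdf_level[OF Q] step_cdf_def monoD)
  then show ?thesis
    by (simp add: midpoint_target_def step_cdf_level_0[OF Q] field_simps)
qed

section \<open>Non-emptiness, boundedness and closedness of the feasible set\<close>

lemma feasible_iff:
  assumes "M \<ge> 1"
  shows "h \<in> feasible K Q M C \<epsilon> \<longleftrightarrow> 0 < h \<and> (\<forall>j\<in>{1..M}. \<bar>deviation K Q M C j h\<bar> \<le> \<epsilon>)"
  \<comment> \<open>An index must exist: positivity of \<open>h\<close> comes from membership in
    some \<open>feasible_at\<close>, here the one for index 1.\<close>
  using assms by (auto simp: feasible_def feasible_at_def intro: bexI[of _ 1])

lemma feasible_nonempty:
  assumes K: "is_kernel K" and Q: "step_cdf Q M C" and M: "M \<ge> 1" and "\<epsilon> > 0"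
  shows "feasible K Q M C \<epsilon> \<noteq> {}"
proof -
  have "\<forall>\<^sub>F h in at_right 0. \<forall>j\<in>{1..M}. \<bar>deviation K Q M C j h\<bar> < \<epsilon>"
  proof (rule eventually_ball_finite, simp, rule ballI)
    fix j assume "j \<in> {1..M}"
    from tendsto_rabs_zero[OF deviation_at_0[OF K Q this]] \<open>\<epsilon> > 0\<close>
    show "\<forall>\<^sub>F h in at_right 0. \<bar>deviation K Q M C j h\<bar> < \<epsilon>"
      by (rule order_tendstoD)
  qed
  then have "\<forall>\<^sub>F h in at_right 0. h \<in> feasible K Q M C \<epsilon>"
    using eventually_at_right_less[of 0]
    by eventually_elim (auto simp: feasible_iff[OF M] intro: less_imp_le)
  then show ?thesis
    using eventually_happens' trivial_limit_at_right_real by fastforce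
qed

text \<open>A single index suffices, since \<open>feasible\<close> is an intersection: for large
  \<open>h\<close> the deviation at \<open>j\<close> is close to a limit of absolute value above
  \<epsilon>.\<close>

lemma feasible_bdd_above:
  assumes K: "is_kernel K" and Q: "step_cdf Q M C" and j: "j \<in> {1..M}"
    and \<epsilon>: "\<epsilon> < \<bar>level Q C M / 2 - midpoint_target Q C j\<bar>"
  shows "bdd_above (feasible K Q M C \<epsilon>)"
proof -
  have "\<forall>\<^sub>F h in at_top. \<epsilon> < \<bar>deviation K Q M C j h\<bar>"
    using tendsto_rabs[OF deviation_at_top[OF K Q]] \<epsilon> by (rule order_tendstoD)
  then obtain N where N: "\<And>h. h \<ge> N \<Longrightarrow> \<epsilon> < \<bar>deviation K Q M C j h\<bar>"
    by (auto simp: eventually_at_top_linorder)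
  have "h \<le> N" if "h \<in> feasible K Q M C \<epsilon>" for h
    using N[of h] that j by (force simp: feasible_def feasible_at_def not_le[symmetric])
  then show ?thesis
    by (rule bdd_aboveI)
qed

lemma h_star_mem_feasible:
  assumes K: "is_kernel K" and M: "M \<ge> 1"
    and ne: "feasible K Q M C \<epsilon> \<noteq> {}" and bdd: "bdd_above (feasible K Q M C \<epsilon>)"
  shows "h_star K Q M C \<epsilon> \<in> feasible K Q M C \<epsilon>"
proof -
  let ?F = "feasible K Q M C \<epsilon>"
  obtain h0 where "h0 \<in> ?F"
    using ne by blast
  then have pos: "0 < h_star K Q M C \<epsilon>"
    using cSup_upper[OF _ bdd] by (force simp: h_star_def feasible_iff[OF M])
  have "h_star K Q M C \<epsilon> \<in> closure ?F"
    unfolding h_star_def using ne bdd by (rule closure_contains_Sup)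
  then obtain u where u: "\<And>n. u n \<in> ?F" "u \<longlonglongrightarrow> h_star K Q M C \<epsilon>"
    by (auto simp: closure_sequential)
  have "\<bar>deviation K Q M C j (h_star K Q M C \<epsilon>)\<bar> \<le> \<epsilon>" if "j \<in> {1..M}" for j
  proof (rule LIMSEQ_le_const2)
    show "(\<lambda>n. \<bar>deviation K Q M C j (u n)\<bar>) \<longlonglongrightarrow> \<bar>deviation K Q M C j (h_star K Q M C \<epsilon>)\<bar>"
      using pos by (intro tendsto_rabs isCont_tendsto_compose[OF isCont_deviation[OF K] u(2)]) simp
    show "\<exists>N. \<forall>n\<ge>N. \<bar>deviation K Q M C j (u n)\<bar> \<le> \<epsilon>"
      using u(1) that by (auto simp: feasible_iff[OF M])
  qed
  with pos show ?thesis
    by (simp add: feasible_iff[OF M])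
qed

theorem proposition3:
  fixes K Q :: "real \<Rightarrow> real" and C :: "nat \<Rightarrow> real" and M :: nat
  assumes "is_kernel K"
    and "step_cdf Q M C"
    and "M \<ge> 2"
  shows "\<exists>\<epsilon>0>0. \<forall>\<epsilon>. 0 < \<epsilon> \<and> \<epsilon> < \<epsilon>0 \<longrightarrow>
    feasible K Q M C \<epsilon> = {h. 0 < h \<and> (MAX j\<in>{1..M}. \<bar>deviation K Q M C j h\<bar>) \<le> \<epsilon>} \<and>
    feasible K Q M C \<epsilon> \<noteq> {} \<and>
    bdd_above (feasible K Q M C \<epsilon>) \<and>
    0 < h_star K Q M C \<epsilon> \<and>
    h_star K Q M C \<epsilon> \<in> feasible K Q M C \<epsilon> \<and>
    (\<forall>h\<in>feasible K Q M C \<epsilon>. h \<le> h_star K Q M C \<epsilon>)"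
proof -
  note K = assms(1) and Q = assms(2)
  have M: "M \<ge> 1"
    using assms(3) by simp
  \<comment> \<open>If both limits vanished, the first and last targets would coincide, yet they
    differ by at least \<open>level Q C M / 2\<close>, which is positive.\<close>
  have "level Q C M / 2 - midpoint_target Q C 1 \<noteq> 0 \<or> level Q C M / 2 - midpoint_target Q C M \<noteq> 0"
    using midpoint_target_diff[OF Q assms(3)] step_cdf_level_last_pos[OF Q M] by linarith
  then obtain j where j: "j \<in> {1..M}" "level Q C M / 2 - midpoint_target Q C j \<noteq> 0"
    using M by fastforce
  show ?thesis
  proof (intro exI[of _ "\<bar>level Q C M / 2 - midpoint_target Q C j\<bar>"] conjI allI impI; (elim conjE)?)
    show "0 < \<bar>level Q C M / 2 - midpoint_target Q C j\<bar>"
      using j(2) by simp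
  next
    fix \<epsilon> :: real
    assume \<epsilon>: "0 < \<epsilon>" "\<epsilon> < \<bar>level Q C M / 2 - midpoint_target Q C j\<bar>"
    show "feasible K Q M C \<epsilon> = {h. 0 < h \<and> (MAX j\<in>{1..M}. \<bar>deviation K Q M C j h\<bar>) \<le> \<epsilon>}"
      \<comment> \<open>The index set is finite and non-empty, so a bound on the maximum is a bound
        on every member.\<close>
      using M by (auto simp: feasible_iff[OF M])
    show ne: "feasible K Q M C \<epsilon> \<noteq> {}"
      using feasible_nonempty[OF K Q M \<epsilon>(1)] .
    show bdd: "bdd_above (feasible K Q M C \<epsilon>)"
      using feasible_bdd_above[OF K Q j(1) \<epsilon>(2)] .
    show mem: "h_star K Q M C \<epsilon> \<in> feasible K Q M C \<epsilon>"
      using h_star_mem_feasible[OF K M ne bdd] .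
    then show "0 < h_star K Q M C \<epsilon>"
      by (simp add: feasible_iff[OF M])
    show "\<forall>h\<in>feasible K Q M C \<epsilon>. h \<le> h_star K Q M C \<epsilon>"
      unfolding h_star_def using bdd by (auto intro: cSup_upper)
  qed
qed

end
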